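(* Let $(S,\mu,\prec)$ be an ordered probability space and let $W$ be a kernel on $S$. Then $\Omega(W,\prec)=0$ if and only if $W$ is a.e. equal to a monotone kernel on $(S,\prec)$.
   Context: An ordered probability space $(S,\mu,\prec)$ is a probability space $(S,\mathcal F,\mu)$ together with a (strict) linear order $\prec$ on $S$ that is measurable, i.e., $\{(x,y):x\prec y\}$ is a measurable subset of $S\times S$ (with the product $\sigma$-field). A kernel on $S$ is a symmetric measurable function $W:S^2\to[0,1]$. It is monotone on $(S,\prec)$ if $W(x_1,y_1)\le W(x_2,y_2)$ whenever $x_1\preceq x_2$ and $y_1\preceq y_2$. For a measurable set $A\subseteq S$, let $$\Omega_1(W,\prec,A)=\iint_{x\prec y}\Bigl(\int_A W(x,z)\,d\mu(z)-\int_A W(y,z)\,d\mu(z)\Bigr)_+\,d\mu(x)\,d\mu(y),$$ where $t_+=\max\{t,0\}$, and let $\Omega_1(W,\prec)=\sup_{A}\Omega_1(W,\prec,A)$ over measurable $A\subseteq S$. Here $\Omega(W,\prec)$ means $\Omega_1(W,\prec)$. *)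

theory Defs
  imports "HOL-Probability.Probability"
begin

text \<open>The strict order is a set of pairs; membership in the product sigma-algebra
  also yields that it is a relation on \<^term>\<open>space M\<close>.\<close>

locale ordered_prob_space = prob_space M for M :: "'a measure" +
  fixes r :: "'a rel"
  assumes strict_linear_order: "strict_linear_order_on (space M) r"
    and measurable_order: "r \<in> sets (M \<Otimes>\<^sub>M M)"

definition is_kernel :: "'a measure \<Rightarrow> ('a \<Rightarrow> 'a \<Rightarrow> real) \<Rightarrow> bool" where
  "is_kernel M W \<longleftrightarrow>
     (\<lambda>(x, y). W x y) \<in> borel_measurable (M \<Otimes>\<^sub>M M) \<and>
     (\<forall>x\<in>space M. \<forall>y\<in>space M. W x y = W y x \<and> W x y \<in> {0..1})"

definition monotone_kernel :: "'a measure \<Rightarrow> 'a rel \<Rightarrow> ('a \<Rightarrow> 'a \<Rightarrow> real) \<Rightarrow> bool" where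
  "monotone_kernel M r W \<longleftrightarrow>
     is_kernel M W \<and>
     (\<forall>x1\<in>space M. \<forall>x2\<in>space M. \<forall>y1\<in>space M. \<forall>y2\<in>space M.
        (x1, x2) \<in> r\<^sup>= \<longrightarrow> (y1, y2) \<in> r\<^sup>= \<longrightarrow> W x1 y1 \<le> W x2 y2)"

definition Omega1_on :: "'a measure \<Rightarrow> ('a \<Rightarrow> 'a \<Rightarrow> real) \<Rightarrow> 'a rel \<Rightarrow> 'a set \<Rightarrow> real" where
  "Omega1_on M W r A =
     (LINT (x, y):r|M \<Otimes>\<^sub>M M. max ((LINT z:A|M. W x z) - (LINT z:A|M. W y z)) 0)"

text \<open>For a kernel on a probability space the values \<^term>\<open>Omega1_on M W r A\<close> lie in
  \<open>[0, 1]\<close>, so the real-valued supremum is the genuine one.\<close>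

definition Omega1 :: "'a measure \<Rightarrow> ('a \<Rightarrow> 'a \<Rightarrow> real) \<Rightarrow> 'a rel \<Rightarrow> real" where
  "Omega1 M W r = (SUP A\<in>sets M. Omega1_on M W r A)"

end

theory Submission
  imports Defs
begin

text \<open>
  If \<open>\<Omega>(W, \<prec>) = 0\<close>, then for each measurable \<open>A\<close> the function \<open>x \<mapsto> \<integral>\<^sub>A W(x, z) dz\<close> is increasing off a null set
  of pairs \<open>x \<prec> y\<close>. Approximating \<open>{(x, y, z). W(x, z) > W(y, z)}\<close> in measure by finite unions of
  rectangles removes the dependence of the null set on \<open>A\<close>: for almost all \<open>x \<prec> y\<close> and almost all \<open>z\<close>,
  \<open>W(x, z) \<le> W(y, z)\<close>. Now let \<open>V(x, y)\<close> be the essential supremum of \<open>W\<close> over the closed quadrant below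
  \<open>(x, y)\<close>. It is monotone everywhere, and \<open>V \<le> W\<close> a.e. by what was just said. For \<open>W \<le> V\<close> a.e. it
  suffices that almost every point of a measurable \<open>E \<subseteq> S \<times> S\<close> has a non-null part of \<open>E\<close> in the quadrant
  below it. By Fubini this reduces to dimension one, where the set \<open>D'\<close> of those points of \<open>D\<close> that have only
  a null part of \<open>D\<close> at or below them satisfies \<open>\<mu>(D')\<^sup>2 = 0\<close>, since of any two points one is at or below
  the other.
\<close>

section \<open>Approximation in measure by finite unions of rectangles\<close>

text \<open>The sets that \<open>\<A>\<close> approximates in measure form a sigma-algebra:
  complementing both sets leaves the symmetric difference unchanged, and a countable union is first
  cut off at a finite stage, by continuity from below, and then approximated piece by piece.\<close>

lemma (in finite_measure) algebra_approximation:
  assumes alg: "algebra (space M) \<A>" and gen: "sets M = sigma_sets (space M) \<A>"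
    and C: "C \<in> sets M" and e: "0 < e"
  shows "\<exists>A\<in>\<A>. measure M (sym_diff C A) < e"
proof -
  interpret algebra "space M" \<A> by (rule alg)
  have \<A>_sets [simp]: "A \<in> sets M" if "A \<in> \<A>" for A
    using that gen by auto
  from C have "C \<in> sigma_sets (space M) \<A>" by (simp add: gen)
  then show ?thesis using e
  proof (induction C arbitrary: e)
    case (Basic A)
    then show ?case by (intro bexI[of _ A]) auto
  next
    case Empty
    then show ?case by (intro bexI[of _ "{}"]) auto
  next
    case (Compl C)
    then obtain A where A: "A \<in> \<A>" "measure M (sym_diff C A) < e" by blast
    have "C \<subseteq> space M" "A \<subseteq> space M"
      using Compl(1) A(1) sigma_sets_into_sp[OF space_closed] space_closed by auto
    then have "sym_diff (space M - C) (space M - A) = sym_diff C A" by auto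
    with A show ?case by (intro bexI[of _ "space M - A"]) auto
  next
    case (Union C)
    have C_sets [simp]: "C i \<in> sets M" for i
      using Union(1) gen by auto
    have "(\<lambda>n. measure M (\<Union>i<n. C i)) \<longlonglongrightarrow> measure M (\<Union>n. \<Union>i<n. C i)"
      by (intro finite_Lim_measure_incseq) (force simp: incseq_def)+
    also have "(\<Union>n. \<Union>i<n. C i) = (\<Union>i. C i)" by auto
    finally have "\<forall>\<^sub>F n in sequentially. measure M (\<Union>i. C i) - e / 2 < measure M (\<Union>i<n. C i)"
      by (rule order_tendstoD(1)) (use Union(3) in simp)
    then obtain n where n: "measure M (\<Union>i. C i) - e / 2 < measure M (\<Union>i<n. C i)"
      by (auto simp: eventually_sequentially)
    \<comment> \<open>The \<open>n\<close> errors of this size add up to at most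
      \<open>e / 2\<close>, the other half being spent on the tail. The summand 2 keeps the
      denominator positive when \<open>n = 0\<close>.\<close>
    have "\<exists>A. A \<in> \<A> \<and> measure M (sym_diff (C i) A) < e / (2 * real n + 2)" for i
      using Union(2)[of "e / (2 * real n + 2)" i] Union(3) by (auto simp: Bex_def)
    then obtain A where A: "\<And>i. A i \<in> \<A>"
      "\<And>i. measure M (sym_diff (C i) (A i)) < e / (2 * real n + 2)"
      by metis
    let ?tail = "(\<Union>i. C i) - (\<Union>i<n. C i)" and ?err = "\<Union>i<n. sym_diff (C i) (A i)"
    have A_sets: "A i \<in> sets M" for i using A(1) by simp
    have tail: "?tail \<in> sets M" and err: "?err \<in> sets M"
      using A_sets by (auto intro!: sets.Diff sets.countable_UN sets.finite_UN sets.Un)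
    have UnA: "(\<Union>i<n. A i) \<in> \<A>" using A(1) by auto
    have "measure M (sym_diff (\<Union>i. C i) (\<Union>i<n. A i)) \<le> measure M (?tail \<union> ?err)"
      using tail err by (intro finite_measure_mono) auto
    also have "\<dots> \<le> measure M ?tail + measure M ?err"
      using tail err by (intro measure_Un_le)
    also have "measure M ?tail = measure M (\<Union>i. C i) - measure M (\<Union>i<n. C i)"
      by (intro finite_measure_Diff) auto
    also have "measure M ?err \<le> (\<Sum>i<n. measure M (sym_diff (C i) (A i)))"
      using A_sets by (intro measure_UNION_le) (auto intro!: sets.Un sets.Diff)
    also have "\<dots> \<le> (\<Sum>i<n. e / (2 * real n + 2))"
      using A(2) by (intro sum_mono less_imp_le)
    also have "\<dots> \<le> e / 2"
      using Union(3) by (simp add: field_simps)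
    finally have "measure M (sym_diff (\<Union>i. C i) (\<Union>i<n. A i)) < e"
      using n by linarith
    with UnA show ?case by blast
  qed
qed

text \<open>The finite unions of measurable rectangles, in a form that makes closure under complements and
  unions immediate.\<close>

definition layered_sets :: "'a measure \<Rightarrow> 'b measure \<Rightarrow> ('a \<times> 'b) set set" where
  "layered_sets N M =
     {{(p, z). z \<in> space M \<and> p \<in> D (h z)} | D (h :: 'b \<Rightarrow> nat).
        simple_function M h \<and> (\<forall>i. D i \<in> sets N)}"

lemma layered_setsI:
  fixes h :: "'b \<Rightarrow> nat"
  shows "simple_function M h \<Longrightarrow> (\<And>i. D i \<in> sets N) \<Longrightarrow>
    {(p, z). z \<in> space M \<and> p \<in> D (h z)} \<in> layered_sets N M"
  by (auto simp: layered_sets_def)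

lemma layered_setsE:
  assumes "A \<in> layered_sets N M"
  obtains D and h :: "'b \<Rightarrow> nat" where "simple_function M h" "\<And>i. D i \<in> sets N"
    "A = {(p, z). z \<in> space M \<and> p \<in> D (h z)}"
  using assms by (auto simp: layered_sets_def)

lemma layered_sets_subset: "layered_sets N M \<subseteq> sets (N \<Otimes>\<^sub>M M)"
proof
  fix A assume "A \<in> layered_sets N M"
  then obtain D and h :: "'b \<Rightarrow> nat" where h: "simple_function M h" and D: "\<And>i. D i \<in> sets N"
    and A: "A = {(p, z). z \<in> space M \<and> p \<in> D (h z)}"
    by (rule layered_setsE) (rule that)
  have "A = (\<Union>i\<in>h ` space M. D i \<times> (h -` {i} \<inter> space M))"
    by (auto simp: A)
  also have "\<dots> \<in> sets (N \<Otimes>\<^sub>M M)"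
    using simple_functionD[OF h] D by (intro sets.finite_UN pair_measureI) auto
  finally show "A \<in> sets (N \<Otimes>\<^sub>M M)" .
qed

lemma rectangle_in_layered_sets:
  assumes "D \<in> sets N" "B \<in> sets M"
  shows "D \<times> B \<in> layered_sets N M"
proof -
  have "B \<subseteq> space M" using assms sets.sets_into_space by auto
  then have "D \<times> B = {(p, z). z \<in> space M \<and> p \<in> (if (indicator B z :: nat) = 1 then D else {})}"
    by (auto simp: indicator_def split: if_splits)
  also have "\<dots> \<in> layered_sets N M"
    using assms by (intro layered_setsI[where D = "\<lambda>i. if i = 1 then D else {}"]) auto
  finally show ?thesis .
qed

lemma algebra_layered_sets: "algebra (space (N \<Otimes>\<^sub>M M)) (layered_sets N M)"
  unfolding algebra_iff_Un
proof (intro conjI ballI)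
  show "layered_sets N M \<subseteq> Pow (space (N \<Otimes>\<^sub>M M))"
    using layered_sets_subset sets.space_closed by (rule order_trans)
  show "{} \<in> layered_sets N M"
    using rectangle_in_layered_sets[of "{}" N "{}" M] by simp
next
  fix A assume "A \<in> layered_sets N M"
  then obtain D and h :: "_ \<Rightarrow> nat" where h: "simple_function M h" and D: "\<And>i. D i \<in> sets N"
    and A: "A = {(p, z). z \<in> space M \<and> p \<in> D (h z)}"
    by (rule layered_setsE) (rule that)
  have "space (N \<Otimes>\<^sub>M M) - A = {(p, z). z \<in> space M \<and> p \<in> space N - D (h z)}"
    by (auto simp: A space_pair_measure)
  also have "\<dots> \<in> layered_sets N M"
    using h D by (intro layered_setsI[where D = "\<lambda>i. space N - D i"]) auto
  finally show "space (N \<Otimes>\<^sub>M M) - A \<in> layered_sets N M" .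
next
  fix A B assume "A \<in> layered_sets N M" "B \<in> layered_sets N M"
  from this(1) obtain D and h :: "_ \<Rightarrow> nat"
    where h: "simple_function M h" and D: "\<And>i. D i \<in> sets N"
      and A: "A = {(p, z). z \<in> space M \<and> p \<in> D (h z)}"
    by (rule layered_setsE) (rule that)
  from \<open>B \<in> layered_sets N M\<close> obtain D' and h' :: "_ \<Rightarrow> nat"
    where h': "simple_function M h'" and D': "\<And>i. D' i \<in> sets N"
      and B: "B = {(p, z). z \<in> space M \<and> p \<in> D' (h' z)}"
    by (rule layered_setsE) (rule that)
  \<comment> \<open>Encoding the pair of labels as one number gives the common refinement of the two
    partitions of \<open>space M\<close>.\<close>
  let ?D = "\<lambda>k. D (fst (prod_decode k)) \<union> D' (snd (prod_decode k))"
  have "A \<union> B = {(p, z). z \<in> space M \<and> p \<in> ?D (prod_encode (h z, h' z))}"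
    by (auto simp: A B)
  also have "\<dots> \<in> layered_sets N M"
    using h h' D D'
    by (intro layered_setsI[where D = ?D] simple_function_compose2[where h = "\<lambda>a b. prod_encode (a, b)"]) auto
  finally show "A \<union> B \<in> layered_sets N M" .
qed

lemma sets_pair_measure_layered_sets:
  "sets (N \<Otimes>\<^sub>M M) = sigma_sets (space (N \<Otimes>\<^sub>M M)) (layered_sets N M)"
proof
  show "sets (N \<Otimes>\<^sub>M M) \<subseteq> sigma_sets (space (N \<Otimes>\<^sub>M M)) (layered_sets N M)"
    unfolding sets_pair_measure space_pair_measure
    by (intro sigma_sets_mono') (auto intro: rectangle_in_layered_sets)
  show "sigma_sets (space (N \<Otimes>\<^sub>M M)) (layered_sets N M) \<subseteq> sets (N \<Otimes>\<^sub>M M)"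
    by (intro sets.sigma_sets_subset layered_sets_subset)
qed

section \<open>A null set independent of the test set\<close>

text \<open>In \<open>nonpos\<close> the exceptional set of \<open>p\<close> may depend on
  \<open>A\<close>. A layered set involves only finitely many test sets, so the integral of
  \<open>g\<close> over it is at most 0. As \<open>g\<close> is bounded, approximation carries this
  over to the set where \<open>g\<close> is positive, which is therefore null.\<close>

lemma AE_nonpos_pair_measure:
  fixes g :: "'a \<times> 'b \<Rightarrow> real"
  assumes "finite_measure N" "finite_measure M"
    and g [measurable]: "g \<in> borel_measurable (N \<Otimes>\<^sub>M M)"
    and bound: "\<And>w. w \<in> space (N \<Otimes>\<^sub>M M) \<Longrightarrow> \<bar>g w\<bar> \<le> B"
    and nonpos: "\<And>A. A \<in> sets M \<Longrightarrow> AE p in N. (LINT z:A|M. g (p, z)) \<le> 0"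
  shows "AE w in N \<Otimes>\<^sub>M M. g w \<le> 0"
proof -
  interpret N: finite_measure N by fact
  interpret M: finite_measure M by fact
  interpret pair_sigma_finite N M ..
  interpret NM: finite_measure "N \<Otimes>\<^sub>M M"
    by (rule finite_measure_pair_measure) fact+
  have intg: "integrable (N \<Otimes>\<^sub>M M) g"
    using bound by (intro NM.integrable_const_bound[where B = B]) auto
  have layered: "(LINT w:A|N \<Otimes>\<^sub>M M. g w) \<le> 0" if "A \<in> layered_sets N M" for A
  proof -
    from that obtain D and h :: "'b \<Rightarrow> nat"
      where h: "simple_function M h" and D [measurable]: "\<And>i. D i \<in> sets N"
        and A: "A = {(p, z). z \<in> space M \<and> p \<in> D (h z)}"
      by (rule layered_setsE) (rule that)
    have A_sets [measurable]: "A \<in> sets (N \<Otimes>\<^sub>M M)"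
      using that layered_sets_subset by blast
    define L where "L i = h -` {i} \<inter> space M" for i
    have L [measurable]: "L i \<in> sets M" for i
      unfolding L_def by (rule simple_functionD[OF h])
    have fin: "finite (h ` space M)" by (rule simple_functionD[OF h])
    \<comment> \<open>\<open>A\<close> is the disjoint union of the rectangles
      \<open>D i \<times> L i\<close> over the finitely many values of \<open>h\<close>, so only
      finitely many null sets are discarded.\<close>
    have "AE p in N. \<forall>i\<in>h ` space M. (LINT z:L i|M. g (p, z)) \<le> 0"
      using fin nonpos[OF L] by (intro AE_finite_allI) auto
    then have "AE p in N. (\<integral>z. indicat_real A (p, z) * g (p, z) \<partial>M) \<le> 0"
      using AE_space
    proof eventually_elim
      case (elim p)
      have int: "integrable M (\<lambda>z. indicat_real (L i) z * g (p, z))" for i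
      proof (rule M.integrable_const_bound)
        have "\<bar>g (p, z)\<bar> \<le> \<bar>B\<bar>" if "z \<in> space M" for z
          using bound[of "(p, z)"] elim(2) that by (auto simp: space_pair_measure)
        then show "AE z in M. norm (indicat_real (L i) z * g (p, z)) \<le> \<bar>B\<bar>"
          by (auto simp: indicator_def)
        show "(\<lambda>z. indicat_real (L i) z * g (p, z)) \<in> borel_measurable M"
          using elim(2) by measurable
      qed
      have "(\<integral>z. indicat_real A (p, z) * g (p, z) \<partial>M) =
          (\<integral>z. (\<Sum>i\<in>h ` space M. indicat_real (D i) p * (indicat_real (L i) z * g (p, z))) \<partial>M)"
      proof (rule Bochner_Integration.integral_cong)
        fix z assume z: "z \<in> space M"
        have "(\<Sum>i\<in>h ` space M. indicat_real (D i) p * (indicat_real (L i) z * g (p, z))) =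
            (\<Sum>i\<in>h ` space M. if i = h z then indicat_real (D i) p * g (p, z) else 0)"
          using z by (intro sum.cong) (auto simp: L_def)
        also have "\<dots> = indicat_real (D (h z)) p * g (p, z)"
          using fin z by (subst sum.delta) auto
        also have "\<dots> = indicat_real A (p, z) * g (p, z)"
          using z by (auto simp: A indicator_def)
        finally show "indicat_real A (p, z) * g (p, z) =
            (\<Sum>i\<in>h ` space M. indicat_real (D i) p * (indicat_real (L i) z * g (p, z)))" ..
      qed simp
      also have "\<dots> = (\<Sum>i\<in>h ` space M. indicat_real (D i) p * (LINT z:L i|M. g (p, z)))"
        using int by (subst Bochner_Integration.integral_sum)
          (auto simp: set_lebesgue_integral_def)
      also have "\<dots> \<le> 0"
        using elim(1) by (intro sum_nonpos mult_nonneg_nonpos) auto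
      finally show ?case .
    qed
    then have "(\<integral>p. (\<integral>z. indicat_real A (p, z) * g (p, z) \<partial>M) \<partial>N) \<le> (\<integral>p. 0 \<partial>N)"
    proof (intro integral_mono_AE)
      show "integrable N (\<lambda>p. \<integral>z. indicat_real A (p, z) * g (p, z) \<partial>M)"
        using integrable_mult_indicator[OF A_sets intg]
        by (intro integrable_fst') simp
    qed auto
    also have "(\<integral>p. (\<integral>z. indicat_real A (p, z) * g (p, z) \<partial>M) \<partial>N) = (LINT w:A|N \<Otimes>\<^sub>M M. g w)"
      using integral_fst'[OF integrable_mult_indicator[OF A_sets intg]]
      by (simp add: set_lebesgue_integral_def)
    finally show ?thesis by simp
  qed
  define C where "C = {w \<in> space (N \<Otimes>\<^sub>M M). 0 < g w}"
  have C [measurable]: "C \<in> sets (N \<Otimes>\<^sub>M M)" unfolding C_def by measurable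
  have set_int: "set_integrable (N \<Otimes>\<^sub>M M) X g" if "X \<in> sets (N \<Otimes>\<^sub>M M)" for X
    using integrable_mult_indicator[OF that intg] by (simp add: set_integrable_def)
  \<comment> \<open>Keeping \<open>0 + \<epsilon>\<close> unsimplified matches the form that
    \<open>field_le_epsilon\<close> expects.\<close>
  have "(LINT w:C|N \<Otimes>\<^sub>M M. g w) \<le> 0 + \<epsilon>" if "0 < \<epsilon>" for \<epsilon>
  proof -
    \<comment> \<open>Replacing \<open>C\<close> by \<open>A\<close> changes the integral by at most
      \<open>\<bar>B\<bar>\<close> times the measure of the symmetric difference; adding 1 avoids a
      zero denominator.\<close>
    have "0 < \<epsilon> / (\<bar>B\<bar> + 1)" using that by (intro divide_pos_pos) auto
    then obtain A where A: "A \<in> layered_sets N M"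
      "measure (N \<Otimes>\<^sub>M M) (sym_diff C A) < \<epsilon> / (\<bar>B\<bar> + 1)"
      using NM.algebra_approximation[OF algebra_layered_sets sets_pair_measure_layered_sets C,
          of "\<epsilon> / (\<bar>B\<bar> + 1)"] by auto
    have A_sets [measurable]: "A \<in> sets (N \<Otimes>\<^sub>M M)"
      using A layered_sets_subset by blast
    let ?S = "sym_diff C A"
    have S: "?S \<in> sets (N \<Otimes>\<^sub>M M)" by (intro sets.Un sets.Diff C A_sets)
    have "(LINT w:C|N \<Otimes>\<^sub>M M. g w) - (LINT w:A|N \<Otimes>\<^sub>M M. g w) =
        (\<integral>w. indicat_real C w * g w - indicat_real A w * g w \<partial>(N \<Otimes>\<^sub>M M))"
      using set_int[OF C] set_int[OF A_sets]
      by (simp add: set_lebesgue_integral_def set_integrable_def)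
    also have "\<dots> \<le> (\<integral>w. indicat_real ?S w * \<bar>B\<bar> \<partial>(N \<Otimes>\<^sub>M M))"
    proof (rule integral_mono)
      show "integrable (N \<Otimes>\<^sub>M M) (\<lambda>w. indicat_real C w * g w - indicat_real A w * g w)"
        using set_int[OF C] set_int[OF A_sets] by (simp add: set_integrable_def)
      show "integrable (N \<Otimes>\<^sub>M M) (\<lambda>w. indicat_real ?S w * \<bar>B\<bar>)"
        by (intro integrable_mult_left integrable_real_indicator) (auto simp: NM.emeasure_finite less_top[symmetric])
      fix w assume "w \<in> space (N \<Otimes>\<^sub>M M)"
      from bound[OF this]
      show "indicat_real C w * g w - indicat_real A w * g w \<le> indicat_real ?S w * \<bar>B\<bar>"
        by (auto simp: indicator_def)
    qed
    also have "\<dots> = measure (N \<Otimes>\<^sub>M M) ?S * \<bar>B\<bar>"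
      by (simp only: integral_mult_left_zero Bochner_Integration.integral_indicator
          Int_absorb2[OF sets.sets_into_space[OF S]])
    also have "\<dots> \<le> \<epsilon> / (\<bar>B\<bar> + 1) * (\<bar>B\<bar> + 1)"
      using A(2) that by (intro mult_mono) auto
    also have "\<dots> = \<epsilon>" by (simp add: add_nonneg_eq_0_iff)
    finally show ?thesis using layered[OF A(1)] by linarith
  qed
  then have le: "(LINT w:C|N \<Otimes>\<^sub>M M. g w) \<le> 0" by (rule field_le_epsilon)
  have nonneg: "AE w in N \<Otimes>\<^sub>M M. 0 \<le> indicat_real C w * g w"
    by (auto simp: C_def indicator_def)
  then have "0 \<le> (LINT w:C|N \<Otimes>\<^sub>M M. g w)"
    unfolding set_lebesgue_integral_def by (intro integral_nonneg_AE) simp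
  with le have "(\<integral>w. indicat_real C w * g w \<partial>(N \<Otimes>\<^sub>M M)) = 0"
    by (simp add: set_lebesgue_integral_def)
  then have "AE w in N \<Otimes>\<^sub>M M. indicat_real C w * g w = 0"
    using integral_nonneg_eq_0_iff_AE[OF _ nonneg] set_int[OF C] by (simp add: set_integrable_def)
  then show ?thesis
    using AE_space by eventually_elim (auto simp: C_def indicator_def split: if_splits)
qed

section \<open>The order, and lower parts of measurable sets\<close>

context ordered_prob_space
begin


definition preceq :: "'a \<Rightarrow> 'a \<Rightarrow> bool" (infix "\<preceq>" 50) where
  "x \<preceq> y \<longleftrightarrow> (x, y) \<in> r\<^sup>="

lemma r_trans: "trans r" and r_irrefl: "irrefl r" and r_total: "total_on (space M) r"
  using strict_linear_order by (auto simp: strict_linear_order_on_def)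

lemma preceq_iff:
  assumes "x \<in> space M" "y \<in> space M"
  shows "x \<preceq> y \<longleftrightarrow> (y, x) \<notin> r"
  using assms r_total[unfolded total_on_def, rule_format, of x y] irreflD[OF r_irrefl]
    transD[OF r_trans, of x y x]
  by (auto simp: preceq_def)

lemma preceq_trans: "x \<preceq> y \<Longrightarrow> y \<preceq> z \<Longrightarrow> x \<preceq> z"
  using transD[OF r_trans, of x y z] by (auto simp: preceq_def)

lemma preceq_linear: "x \<in> space M \<Longrightarrow> y \<in> space M \<Longrightarrow> x \<preceq> y \<or> y \<preceq> x"
  using r_total[unfolded total_on_def, rule_format, of x y] by (auto simp: preceq_def)

text \<open>By linearity the reflexive closure is the complement of the reversed strict order, so
  measurability of \<open>r\<close> suffices and the diagonal needs no separate treatment.\<close>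

lemma measurable_preceq [measurable (raw)]:
  assumes [measurable]: "f \<in> N \<rightarrow>\<^sub>M M" "g \<in> N \<rightarrow>\<^sub>M M"
  shows "Measurable.pred N (\<lambda>x. f x \<preceq> g x)"
proof -
  note measurable_order [measurable]
  have "Measurable.pred N (\<lambda>x. (g x, f x) \<notin> r)" by measurable
  also have "?this \<longleftrightarrow> ?thesis"
    by (rule measurable_cong) (simp add: preceq_iff measurable_space[OF assms(1)] measurable_space[OF assms(2)])
  finally show ?thesis .
qed

text \<open>The set \<open>D'\<close> of bad points has a null part at or below each of its points.
  Exchanging the quantifiers by Fubini shows that, for almost every point, the part of
  \<open>D'\<close> at or above it is null as well; linearity combines the two, so
  \<open>D' \<times> D'\<close> is null. Since \<open>\<preceq>\<close> includes equality, an atom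
  counts in its own lower part.\<close>

lemma AE_lower_section_not_null:
  assumes D [measurable]: "D \<in> sets M"
  shows "AE x in M. x \<in> D \<longrightarrow> emeasure M {x' \<in> space M. x' \<in> D \<and> x' \<preceq> x} \<noteq> 0"
proof -
  interpret MM: pair_prob_space M M ..
  define D' where "D' = {x \<in> space M. x \<in> D \<and> emeasure M {x' \<in> space M. x' \<in> D \<and> x' \<preceq> x} = 0}"
  have D' [measurable]: "D' \<in> sets M" unfolding D'_def by measurable
  have "AE x' in M. \<not> (x \<in> D' \<and> x' \<in> D' \<and> x' \<preceq> x)" if "x \<in> space M" for x
  proof (cases "x \<in> D'")
    case True
    then have "{x' \<in> space M. x' \<in> D \<and> x' \<preceq> x} \<in> null_sets M"
      using that by (auto simp: D'_def)
    then show ?thesis by (rule AE_I') (auto simp: D'_def)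
  qed simp
  then have below: "AE x in M. AE x' in M. \<not> (x \<in> D' \<and> x' \<in> D' \<and> x' \<preceq> x)"
    by simp
  then have "AE x' in M. AE x in M. \<not> (x \<in> D' \<and> x' \<in> D' \<and> x' \<preceq> x)"
    by (rule MM.AE_commute[where P = "\<lambda>x x'. \<not> (x \<in> D' \<and> x' \<in> D' \<and> x' \<preceq> x)", THEN iffD1, rotated])
      measurable
  with below have "AE x in M. AE x' in M. \<not> (x \<in> D' \<and> x' \<in> D')"
    using AE_space
  proof eventually_elim
    case (elim x)
    from elim(1,2) AE_space show ?case
      by eventually_elim (use elim(3) preceq_linear in blast)
  qed
  then have "AE x in M. x \<in> D' \<longrightarrow> (AE x' in M. x' \<notin> D')"
  proof eventually_elim
    case (elim x)
    then show ?case by (cases "x \<in> D'") auto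
  qed
  \<comment> \<open>The conclusion of the implication does not mention \<open>x\<close>: either it
    holds and is the claim itself, or it fails and almost every \<open>x\<close> lies outside
    \<open>D'\<close>.\<close>
  then have "AE x in M. x \<notin> D'"
    by (cases "AE x' in M. x' \<notin> D'") auto
  then show ?thesis
    using AE_space by eventually_elim (auto simp: D'_def)
qed

text \<open>The one-dimensional lemma is used on sections in both directions. For almost every
  \<open>(x, y)\<close> in \<open>E\<close>, a non-null set of \<open>x' \<preceq> x\<close> has
  \<open>(x', y) \<in> E\<close>, and almost all of these satisfy \<open>h x' y \<noteq> 0\<close>,
  that is, the section of \<open>E\<close> over \<open>x'\<close> has a non-null part at or below
  \<open>y\<close>. By Fubini these parts fill a non-null set in the quadrant.\<close>

lemma AE_lower_quadrant_not_null:
  assumes E [measurable]: "E \<in> sets (M \<Otimes>\<^sub>M M)"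
  shows "AE p in M \<Otimes>\<^sub>M M. p \<in> E \<longrightarrow>
    emeasure (M \<Otimes>\<^sub>M M) {p' \<in> space (M \<Otimes>\<^sub>M M). p' \<in> E \<and> fst p' \<preceq> fst p \<and> snd p' \<preceq> snd p} \<noteq> 0"
    (is "AE p in _. p \<in> E \<longrightarrow> emeasure _ (?Q (fst p) (snd p)) \<noteq> 0")
proof -
  interpret MM: pair_prob_space M M ..
  define h where "h x y = emeasure M {y' \<in> space M. (x, y') \<in> E \<and> y' \<preceq> y}" for x y
  have h [measurable]: "case_prod h \<in> borel_measurable (M \<Otimes>\<^sub>M M)"
    unfolding h_def by measurable
  have "(\<lambda>p. emeasure (M \<Otimes>\<^sub>M M) (?Q (fst p) (snd p))) \<in> borel_measurable (M \<Otimes>\<^sub>M M)"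
    by (rule MM.P.measurable_emeasure) (auto, measurable)
  then have Q_meas: "{p \<in> space (M \<Otimes>\<^sub>M M). p \<in> E \<longrightarrow>
      emeasure (M \<Otimes>\<^sub>M M) (?Q (fst p) (snd p)) \<noteq> 0} \<in> sets (M \<Otimes>\<^sub>M M)"
    by measurable
  have E_sec: "{y \<in> space M. (x, y) \<in> E} \<in> sets M" "{x' \<in> space M. (x', x) \<in> E} \<in> sets M"
    if "x \<in> space M" for x
    using that by measurable
  have "AE x in M. AE y in M. (x, y) \<in> E \<longrightarrow> h x y \<noteq> 0"
  proof (rule AE_I2)
    fix x assume "x \<in> space M"
    from AE_lower_section_not_null[OF E_sec(1)[OF this]] AE_space
    show "AE y in M. (x, y) \<in> E \<longrightarrow> h x y \<noteq> 0"
      by eventually_elim (auto simp: h_def)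
  qed
  then have "AE y in M. AE x in M. (x, y) \<in> E \<longrightarrow> h x y \<noteq> 0"
    by (rule MM.AE_commute[where P = "\<lambda>x y. (x, y) \<in> E \<longrightarrow> h x y \<noteq> 0", THEN iffD1, rotated])
      measurable
  then have "AE y in M. AE x in M. (x, y) \<in> E \<longrightarrow> emeasure (M \<Otimes>\<^sub>M M) (?Q x y) \<noteq> 0"
    using AE_space
  proof eventually_elim
    case (elim y)
    note h_pos = elim(1) and y = elim(2)
    from AE_lower_section_not_null[OF E_sec(2)[OF y]] AE_space show ?case
    proof eventually_elim
      case (elim x)
      show ?case
      proof (intro impI notI)
        assume xy: "(x, y) \<in> E" and null: "emeasure (M \<Otimes>\<^sub>M M) (?Q x y) = 0"
        have "?Q x y \<in> sets (M \<Otimes>\<^sub>M M)"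
          using elim(2) y by measurable
        with null have "?Q x y \<in> null_sets (M \<Otimes>\<^sub>M M)" by auto
        then have "AE p in M \<Otimes>\<^sub>M M. p \<notin> ?Q x y" by (rule AE_not_in)
        then have "AE x' in M. AE y' in M. (x', y') \<notin> ?Q x y" by (rule MM.AE_pair)
        with h_pos AE_space have "AE x' in M. \<not> ((x', y) \<in> E \<and> x' \<preceq> x)"
        proof eventually_elim
          case (elim x')
          show ?case
          proof
            assume x': "(x', y) \<in> E \<and> x' \<preceq> x"
            with elim(1) have "h x' y \<noteq> 0" by simp
            moreover have "AE y' in M. \<not> ((x', y') \<in> E \<and> y' \<preceq> y)"
              using elim(3) AE_space
              by eventually_elim (use x' elim(2) in \<open>auto simp: space_pair_measure\<close>)
            then have "h x' y = 0"
              unfolding h_def using elim(2) y by (subst (asm) AE_iff_measurable[OF _ refl]) auto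
            ultimately show False by simp
          qed
        qed
        then have "emeasure M {x' \<in> space M. x' \<in> {x' \<in> space M. (x', y) \<in> E} \<and> x' \<preceq> x} = 0"
          using elim(2) y E_sec(2)[OF y]
          by (subst (asm) AE_iff_measurable[OF _ refl]) (auto cong: conj_cong)
        with elim xy show False by simp
      qed
    qed
  qed
  then have "AE x in M. AE y in M. (x, y) \<in> E \<longrightarrow> emeasure (M \<Otimes>\<^sub>M M) (?Q x y) \<noteq> 0"
    by (rule MM.AE_commute[where P = "\<lambda>x y. (x, y) \<in> E \<longrightarrow> emeasure (M \<Otimes>\<^sub>M M) (?Q x y) \<noteq> 0",
          THEN iffD2, rotated]) (use Q_meas in simp)
  then show ?thesis
    by (intro MM.AE_pair_measure) (use Q_meas in simp_all)
qed

section \<open>From vanishing \<Omega> to almost everywhere monotonicity\<close>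

lemma kernel_section:
  assumes W: "is_kernel M W" and A [measurable]: "A \<in> sets M"
  shows measurable_kernel_section: "(\<lambda>x. LINT z:A|M. W x z) \<in> borel_measurable M"
    and set_integrable_kernel: "x \<in> space M \<Longrightarrow> set_integrable M A (W x)"
    and kernel_section_bounds: "x \<in> space M \<Longrightarrow> (LINT z:A|M. W x z) \<in> {0..1}"
proof -
  have [measurable]: "case_prod W \<in> borel_measurable (M \<Otimes>\<^sub>M M)"
    using W by (simp add: is_kernel_def)
  show "(\<lambda>x. LINT z:A|M. W x z) \<in> borel_measurable M"
    unfolding set_lebesgue_integral_def by measurable
  assume x [measurable]: "x \<in> space M"
  have bounds: "0 \<le> indicat_real A z *\<^sub>R W x z" "indicat_real A z *\<^sub>R W x z \<le> 1" if "z \<in> space M" for z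
    using W x that by (auto simp: is_kernel_def indicator_def)
  have int: "integrable M (\<lambda>z. indicat_real A z *\<^sub>R W x z)"
  proof (rule integrable_const_bound[where B = 1])
    show "AE z in M. norm (indicat_real A z *\<^sub>R W x z) \<le> 1"
      using bounds by (intro AE_I2) auto
  qed measurable
  then show "set_integrable M A (W x)" by (simp add: set_integrable_def)
  have "(LINT z:A|M. W x z) \<le> (\<integral>z. 1 \<partial>M)"
    unfolding set_lebesgue_integral_def using int bounds by (intro integral_mono) auto
  moreover have "0 \<le> (LINT z:A|M. W x z)"
    unfolding set_lebesgue_integral_def using bounds by (intro integral_nonneg_AE AE_I2)
  ultimately show "(LINT z:A|M. W x z) \<in> {0..1}"
    by (simp add: prob_space)
qed

text \<open>A supremum of nonnegative integrals vanishes exactly when every integrand vanishes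
  almost everywhere. The null set of pairs still depends on \<open>A\<close> here.\<close>

lemma Omega1_eq_0_iff:
  assumes W: "is_kernel M W"
  shows "Omega1 M W r = 0 \<longleftrightarrow>
    (\<forall>A\<in>sets M. AE p in M \<Otimes>\<^sub>M M. p \<in> r \<longrightarrow>
      (LINT z:A|M. W (fst p) z) \<le> (LINT z:A|M. W (snd p) z))"
proof -
  interpret MM: pair_prob_space M M ..
  note measurable_order [measurable]
  define F where "F A p = indicat_real r p *
    max ((LINT z:A|M. W (fst p) z) - (LINT z:A|M. W (snd p) z)) 0" for A p
  have Omega: "Omega1_on M W r A = (\<integral>p. F A p \<partial>(M \<Otimes>\<^sub>M M))" for A
    by (simp add: Omega1_on_def set_lebesgue_integral_def F_def case_prod_beta)
  have F_bounds: "0 \<le> F A p" "F A p \<le> 1" if "A \<in> sets M" "p \<in> space (M \<Otimes>\<^sub>M M)" for A p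
    using kernel_section_bounds[OF W that(1), of "fst p"] kernel_section_bounds[OF W that(1), of "snd p"] that(2)
    by (auto simp: F_def space_pair_measure indicator_def)
  have F_int: "integrable (M \<Otimes>\<^sub>M M) (F A)" if A: "A \<in> sets M" for A
  proof (rule MM.P.integrable_const_bound[where B = 1])
    show "AE p in M \<Otimes>\<^sub>M M. norm (F A p) \<le> 1"
      using F_bounds[OF A] by (intro AE_I2) auto
    note measurable_kernel_section[OF W A, measurable]
    show "F A \<in> borel_measurable (M \<Otimes>\<^sub>M M)"
      unfolding F_def by measurable
  qed
  have nonneg: "0 \<le> Omega1_on M W r A" if "A \<in> sets M" for A
    unfolding Omega using F_bounds[OF that] by (intro integral_nonneg_AE AE_I2)
  \<comment> \<open>A bound uniform in \<open>A\<close> is what makes the real supremum an upper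
    bound of its members.\<close>
  have le1: "Omega1_on M W r A \<le> 1" if "A \<in> sets M" for A
  proof -
    have "(\<integral>p. F A p \<partial>(M \<Otimes>\<^sub>M M)) \<le> (\<integral>p. 1 \<partial>(M \<Otimes>\<^sub>M M))"
      using F_bounds[OF that] F_int[OF that] by (intro integral_mono) auto
    then show ?thesis by (simp add: Omega MM.P.prob_space)
  qed
  have "Omega1 M W r = 0 \<longleftrightarrow> (\<forall>A\<in>sets M. Omega1_on M W r A = 0)"
  proof
    assume *: "Omega1 M W r = 0"
    show "\<forall>A\<in>sets M. Omega1_on M W r A = 0"
    proof
      fix A assume A: "A \<in> sets M"
      have "Omega1_on M W r A \<le> Omega1 M W r"
        unfolding Omega1_def using A le1 by (intro cSUP_upper bdd_aboveI2[where M = 1])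
      with * nonneg[OF A] show "Omega1_on M W r A = 0" by simp
    qed
  next
    assume "\<forall>A\<in>sets M. Omega1_on M W r A = 0"
    then have "Omega1 M W r = (SUP A\<in>sets M. 0)"
      unfolding Omega1_def by (intro SUP_cong) auto
    also have "\<dots> = 0" by (intro cSUP_const) (metis empty_iff sets.top)
    finally show "Omega1 M W r = 0" .
  qed
  also have "\<dots> \<longleftrightarrow> (\<forall>A\<in>sets M. AE p in M \<Otimes>\<^sub>M M. F A p = 0)"
    unfolding Omega using F_bounds F_int
    by (intro ball_cong refl integral_nonneg_eq_0_iff_AE AE_I2)
  also have "\<dots> \<longleftrightarrow> (\<forall>A\<in>sets M. AE p in M \<Otimes>\<^sub>M M. p \<in> r \<longrightarrow>
      (LINT z:A|M. W (fst p) z) \<le> (LINT z:A|M. W (snd p) z))"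
    by (intro ball_cong refl AE_cong) (auto simp: F_def max_def)
  finally show ?thesis .
qed

text \<open>The difference of the two sections, cut down to \<open>r\<close>, is a bounded function
  of a pair and a point whose integrals over each test set are nonpositive for almost every pair.
  \<open>AE_nonpos_pair_measure\<close> thus makes the null set independent of \<open>A\<close>; on
  the diagonal the inequality is trivial.\<close>

lemma AE_kernel_mono:
  assumes W: "is_kernel M W" and "Omega1 M W r = 0"
  shows "AE p in M \<Otimes>\<^sub>M M. AE z in M. fst p \<preceq> snd p \<longrightarrow> W (fst p) z \<le> W (snd p) z"
proof -
  interpret MM: pair_prob_space M M ..
  interpret T: pair_sigma_finite "M \<Otimes>\<^sub>M M" M ..
  note measurable_order [measurable]
  have [measurable]: "case_prod W \<in> borel_measurable (M \<Otimes>\<^sub>M M)"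
    using W by (simp add: is_kernel_def)
  define g where "g w = indicat_real r (fst w) * (W (fst (fst w)) (snd w) - W (snd (fst w)) (snd w))"
    for w
  have "AE w in (M \<Otimes>\<^sub>M M) \<Otimes>\<^sub>M M. g w \<le> 0"
  proof (rule AE_nonpos_pair_measure[where B = 1])
    show "finite_measure M" "finite_measure (M \<Otimes>\<^sub>M M)" by unfold_locales
    show "g \<in> borel_measurable ((M \<Otimes>\<^sub>M M) \<Otimes>\<^sub>M M)"
      unfolding g_def by measurable
    fix w assume "w \<in> space ((M \<Otimes>\<^sub>M M) \<Otimes>\<^sub>M M)"
    then have "W (fst (fst w)) (snd w) \<in> {0..1}" "W (snd (fst w)) (snd w) \<in> {0..1}"
      using W by (auto simp: is_kernel_def space_pair_measure)
    then show "\<bar>g w\<bar> \<le> 1"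
      by (auto simp: g_def indicator_def)
  next
    fix A assume A: "A \<in> sets M"
    from assms Omega1_eq_0_iff[OF W] A
    have "AE p in M \<Otimes>\<^sub>M M. p \<in> r \<longrightarrow> (LINT z:A|M. W (fst p) z) \<le> (LINT z:A|M. W (snd p) z)"
      by blast
    then show "AE p in M \<Otimes>\<^sub>M M. (LINT z:A|M. g (p, z)) \<le> 0"
      using AE_space
    proof eventually_elim
      case (elim p)
      then have "fst p \<in> space M" "snd p \<in> space M" by (auto simp: space_pair_measure)
      then have "(LINT z:A|M. g (p, z)) =
          indicat_real r p * ((LINT z:A|M. W (fst p) z) - (LINT z:A|M. W (snd p) z))"
        using set_integrable_kernel[OF W A]
        by (simp add: g_def set_integral_diff)
      also have "\<dots> \<le> 0" using elim(1) by (auto simp: indicator_def)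
      finally show ?case .
    qed
  qed
  then have "AE p in M \<Otimes>\<^sub>M M. AE z in M. g (p, z) \<le> 0"
    by (rule T.AE_pair)
  then show ?thesis
  proof eventually_elim
    case (elim p)
    then show ?case
      by eventually_elim (auto simp: g_def preceq_def indicator_def split: if_splits)
  qed
qed

text \<open>Moving one argument at a time gives \<open>W x' y' \<le> W x y' \<le> W x y\<close>, the
  second inequality through the symmetry of \<open>W\<close>. The work lies in arranging the
  almost-everywhere quantifiers so that \<open>x\<close> and \<open>y\<close> come first.\<close>

lemma AE_kernel_quadrant_mono:
  assumes W: "is_kernel M W" and "Omega1 M W r = 0"
  shows "AE x in M. AE y in M. AE p in M \<Otimes>\<^sub>M M.
    fst p \<preceq> x \<and> snd p \<preceq> y \<longrightarrow> W (fst p) (snd p) \<le> W x y"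
proof -
  interpret MM: pair_prob_space M M ..
  interpret T: pair_sigma_finite "M \<Otimes>\<^sub>M M" M ..
  have [measurable]: "case_prod W \<in> borel_measurable (M \<Otimes>\<^sub>M M)"
    using W by (simp add: is_kernel_def)
  have sym: "W x y = W y x" if "x \<in> space M" "y \<in> space M" for x y
    using W that by (auto simp: is_kernel_def)
  define P where "P a b z \<longleftrightarrow> (a \<preceq> b \<longrightarrow> W a z \<le> W b z)" for a b z
  have mono: "AE p in M \<Otimes>\<^sub>M M. AE z in M. P (fst p) (snd p) z"
    unfolding P_def by (rule AE_kernel_mono) fact+
  have meas3: "{w \<in> space ((M \<Otimes>\<^sub>M M) \<Otimes>\<^sub>M M). P (snd (fst w)) (fst (fst w)) (snd w)}
      \<in> sets ((M \<Otimes>\<^sub>M M) \<Otimes>\<^sub>M M)"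
    unfolding P_def by measurable
  \<comment> \<open>\<open>mono\<close> has the smaller point as first coordinate; the coordinate
    swap preserves the product measure and puts the larger one first.\<close>
  have swap: "AE p in M \<Otimes>\<^sub>M M. Q (snd p) (fst p)" if "AE p in M \<Otimes>\<^sub>M M. Q (fst p) (snd p)" for Q
  proof -
    have "AE p in distr (M \<Otimes>\<^sub>M M) (M \<Otimes>\<^sub>M M) (\<lambda>(x, y). (y, x)). Q (fst p) (snd p)"
      using that by (simp only: MM.distr_pair_swap[symmetric])
    from AE_distrD[OF _ this] show ?thesis by (auto simp: case_prod_beta)
  qed
  have "AE x in M. AE x' in M. AE y' in M. P x' x y'"
    using MM.AE_pair[OF swap[OF mono]] by simp
  \<comment> \<open>For the second inequality the argument held fixed is the third coordinate of the
    triple, so it is moved outermost.\<close>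
  moreover have "AE x in M. AE p in M \<Otimes>\<^sub>M M. P (snd p) (fst p) x"
    using swap[OF mono] by (rule T.AE_commute[where P = "\<lambda>p z. P (snd p) (fst p) z", OF meas3, THEN iffD1])
  ultimately show ?thesis
    using AE_space
  proof eventually_elim
    case (elim x)
    note first = elim(1) and x = elim(3)
    have "AE y in M. AE y' in M. P y' y x"
      using MM.AE_pair[OF elim(2)] by simp
    then show ?case
      using AE_space
    proof eventually_elim
      case (elim y)
      note second = elim(1) and y = elim(2)
      show ?case
      proof (rule MM.AE_pair_measure)
        show "{p \<in> space (M \<Otimes>\<^sub>M M). fst p \<preceq> x \<and> snd p \<preceq> y \<longrightarrow> W (fst p) (snd p) \<le> W x y}
            \<in> sets (M \<Otimes>\<^sub>M M)"
          using x y by measurable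
        from first show "AE x' in M. AE y' in M.
            fst (x', y') \<preceq> x \<and> snd (x', y') \<preceq> y \<longrightarrow> W (fst (x', y')) (snd (x', y')) \<le> W x y"
        proof eventually_elim
          case (elim x')
          from elim second AE_space show ?case
            by eventually_elim (use x y sym in \<open>fastforce simp: P_def\<close>)
        qed
      qed
    qed
  qed
qed

section \<open>The essential supremum over lower quadrants\<close>

definition quadrant :: "'a \<Rightarrow> 'a \<Rightarrow> ('a \<times> 'a) set" where
  "quadrant x y = {p \<in> space (M \<Otimes>\<^sub>M M). fst p \<preceq> x \<and> snd p \<preceq> y}"

text \<open>The essential supremum of \<open>W\<close> over the closed quadrant below \<open>(x, y)\<close>; restricting to rational
  levels makes its measurability evident.\<close>

definition quadrant_esssup :: "('a \<Rightarrow> 'a \<Rightarrow> real) \<Rightarrow> 'a \<Rightarrow> 'a \<Rightarrow> real" where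
  "quadrant_esssup W x y = (SUP q\<in>\<rat> \<inter> {0..1}.
     if emeasure (M \<Otimes>\<^sub>M M) {p \<in> quadrant x y. q < W (fst p) (snd p)} = 0 then 0 else q)"

context
  fixes W :: "'a \<Rightarrow> 'a \<Rightarrow> real"
  assumes W: "is_kernel M W"
begin

lemma kernel_measurable [measurable]: "case_prod W \<in> borel_measurable (M \<Otimes>\<^sub>M M)"
  using W by (simp add: is_kernel_def)

lemma measurable_super_level:
  "{p \<in> quadrant x y. q < W (fst p) (snd p)} \<in> sets (M \<Otimes>\<^sub>M M)" if "x \<in> space M" "y \<in> space M"
proof -
  have "{p \<in> space (M \<Otimes>\<^sub>M M). (fst p \<preceq> x \<and> snd p \<preceq> y) \<and> q < W (fst p) (snd p)} \<in> sets (M \<Otimes>\<^sub>M M)"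
    using that by measurable
  then show ?thesis by (simp add: quadrant_def conj_ac)
qed

lemma bdd_above_levels:
  "bdd_above ((\<lambda>q. if Q q then 0 else q) ` (\<rat> \<inter> {0..1 :: real}))"
  by (rule bdd_aboveI2[where M = 1]) auto

lemma measurable_quadrant_esssup:
  "case_prod (quadrant_esssup W) \<in> borel_measurable (M \<Otimes>\<^sub>M M)"
proof -
  interpret MM: pair_prob_space M M ..
  have [measurable]: "(\<lambda>w. emeasure (M \<Otimes>\<^sub>M M) {p \<in> quadrant (fst w) (snd w). q < W (fst p) (snd p)})
      \<in> borel_measurable (M \<Otimes>\<^sub>M M)" for q
  proof (rule MM.P.measurable_emeasure)
    have "{v \<in> space ((M \<Otimes>\<^sub>M M) \<Otimes>\<^sub>M (M \<Otimes>\<^sub>M M)). fst (snd v) \<preceq> fst (fst v) \<and>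
        snd (snd v) \<preceq> snd (fst v) \<and> q < W (fst (snd v)) (snd (snd v))}
        \<in> sets ((M \<Otimes>\<^sub>M M) \<Otimes>\<^sub>M (M \<Otimes>\<^sub>M M))"
      by measurable
    also have "?this \<longleftrightarrow> {v \<in> space ((M \<Otimes>\<^sub>M M) \<Otimes>\<^sub>M (M \<Otimes>\<^sub>M M)).
        snd v \<in> {p \<in> quadrant (fst (fst v)) (snd (fst v)). q < W (fst p) (snd p)}}
        \<in> sets ((M \<Otimes>\<^sub>M M) \<Otimes>\<^sub>M (M \<Otimes>\<^sub>M M))"
      by (rule arg_cong[where f = "\<lambda>X. X \<in> _"]) (auto simp: quadrant_def space_pair_measure)
    finally show \<dots> .
  qed (auto simp: quadrant_def)
  have "(\<lambda>w. quadrant_esssup W (fst w) (snd w)) \<in> borel_measurable (M \<Otimes>\<^sub>M M)"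
    unfolding quadrant_esssup_def
  proof (rule borel_measurable_cSUP)
    show "countable (\<rat> \<inter> {0..1 :: real})"
      using countable_rat by (rule countable_Int1)
  qed (auto intro: bdd_above_levels)
  then show ?thesis by (simp add: case_prod_beta')
qed

text \<open>The coordinate swap preserves the product measure and, \<open>W\<close> being symmetric,
  matches the super-level sets of the two quadrants.\<close>

lemma quadrant_esssup_symmetric: "quadrant_esssup W x y = quadrant_esssup W y x"
  if xy: "x \<in> space M" "y \<in> space M"
proof -
  interpret MM: pair_prob_space M M ..
  have "emeasure (M \<Otimes>\<^sub>M M) {p \<in> quadrant x y. q < W (fst p) (snd p)} =
      emeasure (M \<Otimes>\<^sub>M M) {p \<in> quadrant y x. q < W (fst p) (snd p)}" for q
  proof -
    have "emeasure (M \<Otimes>\<^sub>M M) {p \<in> quadrant x y. q < W (fst p) (snd p)} =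
        emeasure (distr (M \<Otimes>\<^sub>M M) (M \<Otimes>\<^sub>M M) (\<lambda>(x, y). (y, x))) {p \<in> quadrant x y. q < W (fst p) (snd p)}"
      by (simp only: MM.distr_pair_swap[symmetric])
    also have "\<dots> = emeasure (M \<Otimes>\<^sub>M M)
        ((\<lambda>(x, y). (y, x)) -` {p \<in> quadrant x y. q < W (fst p) (snd p)} \<inter> space (M \<Otimes>\<^sub>M M))"
      using measurable_super_level[OF xy] by (intro emeasure_distr measurable_pair_swap')
    also have "(\<lambda>(x, y). (y, x)) -` {p \<in> quadrant x y. q < W (fst p) (snd p)} \<inter> space (M \<Otimes>\<^sub>M M) =
        {p \<in> quadrant y x. q < W (fst p) (snd p)}"
      using W by (auto simp: is_kernel_def quadrant_def space_pair_measure)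
    finally show ?thesis .
  qed
  then show ?thesis by (simp add: quadrant_esssup_def)
qed

lemma quadrant_esssup_bounds: "quadrant_esssup W x y \<in> {0..1}"
proof -
  have "quadrant_esssup W x y \<le> 1"
    unfolding quadrant_esssup_def by (rule cSUP_least) (auto intro: exI[of _ 0])
  \<comment> \<open>The level 0 contributes 0 in either branch, which bounds the supremum from
    below.\<close>
  moreover have "(if emeasure (M \<Otimes>\<^sub>M M) {p \<in> quadrant x y. 0 < W (fst p) (snd p)} = 0 then 0 else 0 :: real)
      \<le> quadrant_esssup W x y"
    unfolding quadrant_esssup_def by (intro cSUP_upper bdd_above_levels) auto
  ultimately show ?thesis by simp
qed

text \<open>Enlarging a quadrant can only turn null super-level sets into non-null ones, so the term
  of each level grows. No points are excepted, because transitivity nests the quadrants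
  everywhere.\<close>

lemma monotone_quadrant_esssup: "monotone_kernel M r (quadrant_esssup W)"
proof -
  have mono: "quadrant_esssup W x1 y1 \<le> quadrant_esssup W x2 y2"
    if "x1 \<preceq> x2" "y1 \<preceq> y2" and sp: "x2 \<in> space M" "y2 \<in> space M" for x1 x2 y1 y2
    unfolding quadrant_esssup_def
  proof (rule cSUP_mono)
    have sub: "{p \<in> quadrant x1 y1. q < W (fst p) (snd p)} \<subseteq> {p \<in> quadrant x2 y2. q < W (fst p) (snd p)}" for q
      using that by (auto simp: quadrant_def intro: preceq_trans)
    fix q :: real assume q: "q \<in> \<rat> \<inter> {0..1}"
    have "emeasure (M \<Otimes>\<^sub>M M) {p \<in> quadrant x1 y1. q < W (fst p) (snd p)}
        \<le> emeasure (M \<Otimes>\<^sub>M M) {p \<in> quadrant x2 y2. q < W (fst p) (snd p)}"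
      by (intro emeasure_mono sub measurable_super_level sp)
    with q show "\<exists>q'\<in>\<rat> \<inter> {0..1}.
        (if emeasure (M \<Otimes>\<^sub>M M) {p \<in> quadrant x1 y1. q < W (fst p) (snd p)} = 0 then 0 else q)
        \<le> (if emeasure (M \<Otimes>\<^sub>M M) {p \<in> quadrant x2 y2. q' < W (fst p) (snd p)} = 0 then 0 else q')"
      by (intro bexI[of _ q]) auto
  qed (auto intro: bdd_above_levels exI[of _ 0])
  show ?thesis
    unfolding monotone_kernel_def is_kernel_def
    using measurable_quadrant_esssup quadrant_esssup_symmetric quadrant_esssup_bounds mono
    unfolding preceq_def by blast
qed

text \<open>This is the inequality where \<Omega> = 0 enters: almost everywhere in the quadrant
  \<open>W\<close> stays below its value at the corner, so every level above that value has a null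
  super-level set and contributes 0.\<close>

lemma quadrant_esssup_le:
  assumes "Omega1 M W r = 0"
  shows "AE p in M \<Otimes>\<^sub>M M. quadrant_esssup W (fst p) (snd p) \<le> W (fst p) (snd p)"
proof -
  interpret MM: pair_prob_space M M ..
  note measurable_quadrant_esssup [measurable]
  show ?thesis
  proof (rule MM.AE_pair_measure)
    from AE_kernel_quadrant_mono[OF W assms] AE_space
    show "AE x in M. AE y in M. quadrant_esssup W (fst (x, y)) (snd (x, y)) \<le> W (fst (x, y)) (snd (x, y))"
    proof eventually_elim
      case (elim x)
      note x = elim(2)
      from elim(1) AE_space show ?case
      proof eventually_elim
        case (elim y)
        have "quadrant_esssup W x y \<le> W x y"
          unfolding quadrant_esssup_def
        proof (rule cSUP_least)
          fix q :: real assume q: "q \<in> \<rat> \<inter> {0..1}"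
          have "emeasure (M \<Otimes>\<^sub>M M) {p \<in> quadrant x y. q < W (fst p) (snd p)} = 0" if "W x y < q"
          proof -
            from elim(1) have "AE p in M \<Otimes>\<^sub>M M. p \<notin> {p \<in> quadrant x y. q < W (fst p) (snd p)}"
              by eventually_elim (use that in \<open>auto simp: quadrant_def\<close>)
            then show ?thesis
              using AE_iff_null_sets[OF measurable_super_level[OF x elim(2)]] by blast
          qed
          \<comment> \<open>Nonnegativity covers the levels replaced by the default value 0.\<close>
          moreover have "0 \<le> W x y" using W x elim(2) by (auto simp: is_kernel_def)
          ultimately show "(if emeasure (M \<Otimes>\<^sub>M M) {p \<in> quadrant x y. q < W (fst p) (snd p)} = 0
              then 0 else q) \<le> W x y"
            by (auto simp: not_less[symmetric])
        qed (auto intro: exI[of _ 0])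
        then show ?case by simp
      qed
    qed
  qed measurable
qed

text \<open>Countably many super-level sets \<open>E q\<close> share one null set. Off it, a
  rational \<open>q\<close> strictly between the essential supremum and \<open>W\<close> would have
  a non-null super-level set in the quadrant and hence be at most the supremum.\<close>

lemma quadrant_esssup_ge:
  "AE p in M \<Otimes>\<^sub>M M. W (fst p) (snd p) \<le> quadrant_esssup W (fst p) (snd p)"
proof -
  define E where "E q = {p \<in> space (M \<Otimes>\<^sub>M M). q < W (fst p) (snd p)}" for q
  have E: "E q \<in> sets (M \<Otimes>\<^sub>M M)" for q
    unfolding E_def by measurable
  have "AE p in M \<Otimes>\<^sub>M M. \<forall>q\<in>\<rat>. p \<in> E q \<longrightarrow> emeasure (M \<Otimes>\<^sub>M M)
      {p' \<in> space (M \<Otimes>\<^sub>M M). p' \<in> E q \<and> fst p' \<preceq> fst p \<and> snd p' \<preceq> snd p} \<noteq> 0"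
    by (intro AE_ball_countable[THEN iffD2] countable_rat ballI AE_lower_quadrant_not_null E)
  then show ?thesis
    using AE_space
  proof eventually_elim
    case (elim p)
    show ?case
    proof (rule ccontr)
      assume "\<not> ?thesis"
      then obtain q where q: "q \<in> \<rat>" "quadrant_esssup W (fst p) (snd p) < q" "q < W (fst p) (snd p)"
        using Rats_dense_in_real[of "quadrant_esssup W (fst p) (snd p)" "W (fst p) (snd p)"] by auto
      have "W (fst p) (snd p) \<le> 1" using W elim(2) by (auto simp: is_kernel_def space_pair_measure)
      then have q01: "q \<in> \<rat> \<inter> {0..1}"
        using q quadrant_esssup_bounds[of "fst p" "snd p"] by auto
      have "{p' \<in> space (M \<Otimes>\<^sub>M M). p' \<in> E q \<and> fst p' \<preceq> fst p \<and> snd p' \<preceq> snd p} =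
          {p' \<in> quadrant (fst p) (snd p). q < W (fst p') (snd p')}"
        by (auto simp: E_def quadrant_def)
      with elim q have "emeasure (M \<Otimes>\<^sub>M M) {p' \<in> quadrant (fst p) (snd p). q < W (fst p') (snd p')} \<noteq> 0"
        by (auto simp: E_def)
      then have "q \<le> quadrant_esssup W (fst p) (snd p)"
        unfolding quadrant_esssup_def
        using cSUP_upper[OF q01 bdd_above_levels,
            of "\<lambda>q. emeasure (M \<Otimes>\<^sub>M M) {p' \<in> quadrant (fst p) (snd p). q < W (fst p') (snd p')} = 0"]
        by simp
      with q show False by simp
    qed
  qed
qed

section \<open>The two implications\<close>

lemma Omega1_eq_0_imp_monotone:
  assumes "Omega1 M W r = 0"
  shows "\<exists>V. monotone_kernel M r V \<and> (AE (x, y) in M \<Otimes>\<^sub>M M. W x y = V x y)"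
proof (intro exI conjI)
  show "AE (x, y) in M \<Otimes>\<^sub>M M. W x y = quadrant_esssup W x y"
    using quadrant_esssup_le[OF assms] quadrant_esssup_ge by eventually_elim auto
qed (rule monotone_quadrant_esssup)

text \<open>By Fubini, passing from \<open>W\<close> to \<open>V\<close> changes the integral over
  \<open>A\<close> only for a null set of first arguments, and for \<open>V\<close> these integrals
  increase along \<open>r\<close> without exception.\<close>

lemma monotone_imp_Omega1_eq_0:
  assumes V: "monotone_kernel M r V" and "AE (x, y) in M \<Otimes>\<^sub>M M. W x y = V x y"
  shows "Omega1 M W r = 0"
  unfolding Omega1_eq_0_iff[OF W]
proof
  interpret MM: pair_prob_space M M ..
  fix A assume A [measurable]: "A \<in> sets M"
  have V_kernel: "is_kernel M V" using V by (simp add: monotone_kernel_def)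
  then have [measurable]: "case_prod V \<in> borel_measurable (M \<Otimes>\<^sub>M M)" by (simp add: is_kernel_def)
  from MM.AE_pair[OF assms(2)] AE_space
  have ae: "AE x in M. (LINT z:A|M. W x z) = (LINT z:A|M. V x z)"
  proof eventually_elim
    case (elim x)
    have "AE z in M. indicat_real A z *\<^sub>R W x z = indicat_real A z *\<^sub>R V x z"
      using elim(1) by eventually_elim simp
    then show ?case
      unfolding set_lebesgue_integral_def using elim(2) by (intro integral_cong_AE) measurable
  qed
  note measurable_kernel_section[OF W A, measurable] measurable_kernel_section[OF V_kernel A, measurable]
  have eq: "AE p in M \<Otimes>\<^sub>M M. (LINT z:A|M. W (fst p) z) = (LINT z:A|M. V (fst p) z)"
      "AE p in M \<Otimes>\<^sub>M M. (LINT z:A|M. W (snd p) z) = (LINT z:A|M. V (snd p) z)"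
    by (rule MM.AE_pair_measure, measurable, use ae in simp)+
  from eq AE_space
  show "AE p in M \<Otimes>\<^sub>M M. p \<in> r \<longrightarrow> (LINT z:A|M. W (fst p) z) \<le> (LINT z:A|M. W (snd p) z)"
  proof eventually_elim
    case (elim p)
    have sp: "fst p \<in> space M" "snd p \<in> space M" using elim(3) by (auto simp: space_pair_measure)
    have "(LINT z:A|M. V (fst p) z) \<le> (LINT z:A|M. V (snd p) z)" if "p \<in> r"
      using sp that V A sets.sets_into_space[OF A]
      by (intro set_integral_mono set_integrable_kernel[OF V_kernel])
        (auto simp: monotone_kernel_def)
    with elim show ?case by simp
  qed
qed

end

end

theorem theorem4p5:
  fixes M :: "'a measure" and r :: "'a rel" and W :: "'a \<Rightarrow> 'a \<Rightarrow> real"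
  assumes "ordered_prob_space M r"
    and "is_kernel M W"
  shows "Omega1 M W r = 0 \<longleftrightarrow>
    (\<exists>V. monotone_kernel M r V \<and> (AE (x, y) in M \<Otimes>\<^sub>M M. W x y = V x y))"
  using ordered_prob_space.Omega1_eq_0_imp_monotone[OF assms]
    ordered_prob_space.monotone_imp_Omega1_eq_0[OF assms] by blast

end
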